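(* Let $(X,S)$ be the $\mathcal S$-adic subshift generated by a positive directive sequence $\boldsymbol\tau=(\tau_n:\mathcal A_{n+1}^*\to\mathcal A_n^* )_{n\ge0}$. If $\liminf_{n\to+\infty}|\mathcal A_n|\le2$, then $$\liminf_{n\to+\infty}\frac{p_X(n)}{n^2}=0.$$
   Context: A directive sequence is a sequence $\boldsymbol\tau=(\tau_n:\mathcal A_{n+1}^*\to\mathcal A_n^* )_{n\ge0}$ of non-erasing morphisms of free monoids over finite alphabets. It is positive if for every $n\ge1$ and every $a\in\mathcal A_{n+1}$ the word $\tau_n(a)$ contains all letters of $\mathcal A_n$ (no such condition on $\tau_0$). The $\mathcal S$-adic subshift $X_{\boldsymbol\tau}$ generated by $\boldsymbol\tau$ is the set of $x\in\mathcal A_0^{\mathbb Z}$ all of whose finite factors occur in $\tau_0\circ\cdots\circ\tau_{N-1}(a)$ for some $N\ge1$ and $a\in\mathcal A_N$. $S$ is the shift map and $p_X(n)$ is the number of words of length $n$ occurring in elements of $X$. *)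

theory Defs
  imports Complex_Main "HOL-Library.Extended_Real" "HOL-Library.Sublist"
begin

text \<open>
  The free monoid over an alphabet \<open>A\<close> is represented by \<open>lists A\<close> with concatenation.  All alphabets
  of a directive sequence are sets of letters of one common type.
\<close>

definition nonerasing_morphism :: "'a set \<Rightarrow> 'a set \<Rightarrow> ('a list \<Rightarrow> 'a list) \<Rightarrow> bool" where
  "nonerasing_morphism B A h \<longleftrightarrow>
     (\<forall>u\<in>lists B. h u \<in> lists A) \<and>
     h [] = [] \<and>
     (\<forall>u\<in>lists B. \<forall>v\<in>lists B. h (u @ v) = h u @ h v) \<and>
     (\<forall>b\<in>B. h [b] \<noteq> [])"

definition directive_sequence ::
    "(nat \<Rightarrow> 'a set) \<Rightarrow> (nat \<Rightarrow> 'a list \<Rightarrow> 'a list) \<Rightarrow> bool" where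
  "directive_sequence A \<tau> \<longleftrightarrow>
     (\<forall>n. finite (A n)) \<and> (\<forall>n. nonerasing_morphism (A (Suc n)) (A n) (\<tau> n))"

text \<open>Positivity puts no condition on \<open>\<tau> 0\<close>.\<close>

definition positive_sequence ::
    "(nat \<Rightarrow> 'a set) \<Rightarrow> (nat \<Rightarrow> 'a list \<Rightarrow> 'a list) \<Rightarrow> bool" where
  "positive_sequence A \<tau> \<longleftrightarrow> (\<forall>n\<ge>1. \<forall>a\<in>A (Suc n). A n \<subseteq> set (\<tau> n [a]))"

text \<open>\<open>compose_upto \<tau> N\<close> is \<open>\<tau> 0 \<circ> \<dots> \<circ> \<tau> (N - 1)\<close>.\<close>

primrec compose_upto :: "(nat \<Rightarrow> 'a list \<Rightarrow> 'a list) \<Rightarrow> nat \<Rightarrow> 'a list \<Rightarrow> 'a list" where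
  "compose_upto \<tau> 0 = id"
| "compose_upto \<tau> (Suc N) = compose_upto \<tau> N \<circ> \<tau> N"

definition factor_at :: "(int \<Rightarrow> 'a) \<Rightarrow> int \<Rightarrow> nat \<Rightarrow> 'a list" where
  "factor_at x i n = map (\<lambda>k. x (i + int k)) [0..<n]"

definition sadic_subshift ::
    "(nat \<Rightarrow> 'a set) \<Rightarrow> (nat \<Rightarrow> 'a list \<Rightarrow> 'a list) \<Rightarrow> (int \<Rightarrow> 'a) set" where
  "sadic_subshift A \<tau> =
     {x. range x \<subseteq> A 0 \<and>
         (\<forall>i n. \<exists>N\<ge>1. \<exists>a\<in>A N. sublist (factor_at x i n) (compose_upto \<tau> N [a]))}"

definition complexity :: "(int \<Rightarrow> 'a) set \<Rightarrow> nat \<Rightarrow> nat" where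
  "complexity X n = card {factor_at x i n | x i. x \<in> X}"

end

theory Submission
  imports Defs
begin

text \<open>
  Let \<open>u\<close> and \<open>v\<close> be the images in \<open>A 0\<close> of the letters of a level with at most two letters, where
  \<open>v\<close> is the shorter one. A window of length \<open>length u\<close> in a concatenation of copies of \<open>u\<close> and \<open>v\<close>
  cannot reach beyond the first \<open>u\<close> that follows the block in which it starts, so it is determined
  by that block, its offset in it, and the number of copies of \<open>v\<close> before the next \<open>u\<close>. This gives
  \<open>p(length u) \<le> 6 (length u)\<^sup>2 / length v\<close>. By positivity, the images of the letters of a level
  are at least as long as those of all lower levels, so \<open>length v\<close> tends to infinity unless the
  subshift is empty.
\<close>

section \<open>Factors of concatenations of two words\<close>

text \<open>Normal form for the start of a window: an offset inside one block, then whole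
  blocks.\<close>

lemma window_concat:
  assumes "j < length (concat xs)"
  shows "\<exists>x ys i. x \<in> set xs \<and> set ys \<subseteq> set xs \<and> i < length x \<and> drop j (concat xs) = drop i x @ concat ys"
  using assms
proof (induction xs arbitrary: j)
  case Nil
  then show ?case by simp
next
  case (Cons z xs)
  show ?case
  proof (cases "j < length z")
    case True
    then have "drop j (concat (z # xs)) = drop j z @ concat xs" by simp
    with True show ?thesis
      by (metis list.set_intros(1) set_subset_Cons)
  next
    case False
    then have "j - length z < length (concat xs)" using Cons.prems by simp
    from Cons.IH[OF this] obtain x ys i where
      "x \<in> set xs" "set ys \<subseteq> set xs" "i < length x"
      "drop (j - length z) (concat xs) = drop i x @ concat ys" by blast
    moreover have "drop j (concat (z # xs)) = drop (j - length z) (concat xs)"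
      using False by simp
    ultimately show ?thesis
      by (metis list.set_intros(2) set_subset_Cons subset_trans)
  qed
qed

text \<open>Leading copies of \<open>v\<close> are stripped one by one. Once a \<open>u\<close> is
  reached it fills the rest of the window, since \<open>M \<le> length u\<close>. The bound on
  \<open>k\<close> says that the last copy of \<open>v\<close> starts inside the window.\<close>

lemma take_concat_two_words:
  assumes "v \<noteq> []" "set ys \<subseteq> {u, v}" "M \<le> length u" "M \<le> length (concat ys)"
  shows "\<exists>k. k * length v < M + length v \<and>
             take M (concat ys) = take M (concat (replicate k v) @ u)"
  using assms(2-)
proof (induction ys arbitrary: M)
  case Nil
  then show ?case using assms(1) by (intro exI[of _ 0]) simp
next
  case (Cons y ys)
  \<comment> \<open>The empty window needs \<open>k = 0\<close>: with \<open>k = 1\<close> the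
    strict bound would fail.\<close>
  consider "M = 0 \<or> y = u" | "M > 0" "y = v" "M \<le> length v" | "y = v" "M > length v"
    using Cons.prems(1) by force
  then show ?case
  proof cases
    case 1
    then show ?thesis using assms(1) Cons.prems by (intro exI[of _ 0]) auto
  next
    case 2
    then show ?thesis by (intro exI[of _ 1]) simp
  next
    case 3
    then obtain k where k: "k * length v < M - length v + length v"
      "take (M - length v) (concat ys) = take (M - length v) (concat (replicate k v) @ u)"
      using Cons.IH[of "M - length v"] Cons.prems by (fastforce simp del: take_append)
    with 3 show ?thesis by (intro exI[of _ "Suc k"]) simp
  qed
qed

definition two_word_factors :: "'a list \<Rightarrow> 'a list \<Rightarrow> 'a list set" where
  "two_word_factors u v = {w. length w = length u \<and> (\<exists>xs. set xs \<subseteq> {u, v} \<and> sublist w (concat xs))}"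

lemma two_word_factors_bound:
  assumes "v \<noteq> []" "length v \<le> length u"
  shows "finite (two_word_factors u v)"
    and "card (two_word_factors u v) \<le> 2 * length u * (length u div length v + 2)"
proof -
  let ?L = "length u"
  \<comment> \<open>A factor is coded by its starting block, the offset there, and the number of
    copies of \<open>v\<close> that follow. Neither block is longer than \<open>?L\<close>, which
    bounds the offset.\<close>
  let ?P = "{u, v} \<times> {..<?L} \<times> {..<?L div length v + 2}"
  let ?f = "\<lambda>(x, i, k). take ?L (drop i x @ concat (replicate k v) @ u)"
  have sub: "two_word_factors u v \<subseteq> ?f ` ?P"
  proof
    fix w assume "w \<in> two_word_factors u v"
    then obtain xs p s where xs: "set xs \<subseteq> {u, v}" "concat xs = p @ w @ s" and len: "length w = ?L"
      unfolding two_word_factors_def sublist_def by blast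
    have "length p < length (concat xs)" using xs(2) len assms by auto
    from window_concat[OF this] obtain x ys i where
      x: "x \<in> {u, v}" "set ys \<subseteq> {u, v}" "i < length x" "w @ s = drop i x @ concat ys"
      using xs by (metis append_eq_conv_conj subset_iff)
    define M where "M = ?L - length (drop i x)"
    have w: "w = take ?L (drop i x) @ take M (concat ys)"
      using x(4) len unfolding M_def by (metis append_eq_conv_conj take_append)
    have "M \<le> length (concat ys)"
      using arg_cong[OF x(4), of length] len unfolding M_def by simp
    then obtain k where k: "k * length v < M + length v"
      "take M (concat ys) = take M (concat (replicate k v) @ u)"
      using take_concat_two_words[OF assms(1) x(2), of M] unfolding M_def by auto
    \<comment> \<open>One copy of \<open>v\<close> is given up to cancel the \<open>length v\<close>
      in the bound on \<open>k\<close>; hence the \<open>+ 2\<close> in the strict range of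
      \<open>?P\<close>.\<close>
    have "(k - 1) * length v \<le> ?L"
      using k(1) unfolding M_def by (cases k) auto
    then have "k - 1 \<le> ?L div length v"
      using assms(1) by (simp add: less_eq_div_iff_mult_less_eq)
    then have "(x, i, k) \<in> ?P" using x assms(2) by auto
    moreover have "w = ?f (x, i, k)" unfolding w k(2) by (simp add: M_def)
    ultimately show "w \<in> ?f ` ?P" by blast
  qed
  have fin: "finite ?P" by simp
  show "finite (two_word_factors u v)"
    using finite_subset[OF sub] fin by blast
  have "card (two_word_factors u v) \<le> card ?P"
    using surj_card_le[OF fin sub] .
  also have "\<dots> = card {u, v} * ?L * (?L div length v + 2)"
    by (simp add: card_cartesian_product algebra_simps)
  also have "\<dots> \<le> 2 * ?L * (?L div length v + 2)"
    by (intro mult_right_mono) (auto simp: card_insert_if)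
  finally show "card (two_word_factors u v) \<le> 2 * ?L * (?L div length v + 2)" .
qed

lemma two_word_factors_ratio:
  assumes "v \<noteq> []" "length v \<le> length u"
  shows "real (card (two_word_factors u v)) / (real (length u))\<^sup>2 \<le> 6 / real (length v)"
proof -
  define L m where "L = real (length u)" and "m = real (length v)"
  have m: "0 < m" "m \<le> L" using assms unfolding L_def m_def by auto
  have "real (card (two_word_factors u v)) \<le> real (2 * length u * (length u div length v + 2))"
    using two_word_factors_bound(2)[OF assms] by (simp only: of_nat_le_iff)
  also have "\<dots> = 2 * L * (real (length u div length v) + 2)"
    unfolding L_def by (simp add: algebra_simps)
  \<comment> \<open>The constant 2 is absorbed by \<open>1 \<le> L / m\<close>, which makes the
    total \<open>6 * L\<^sup>2 / m\<close>.\<close>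
  also have "\<dots> \<le> 2 * L * (L / m + 2 * (L / m))"
    using m of_nat_div_le_of_nat[of "length u" "length v", where ?'a = real]
    by (intro mult_left_mono add_mono) (auto simp: L_def m_def le_divide_eq)
  also have "\<dots> = 6 / m * L\<^sup>2" by (simp add: power2_eq_square)
  finally have "real (card (two_word_factors u v)) \<le> 6 / m * L\<^sup>2" .
  moreover have "0 < L\<^sup>2" using m by simp
  ultimately have "real (card (two_word_factors u v)) / L\<^sup>2 \<le> 6 / m"
    by (simp only: pos_divide_le_eq)
  then show ?thesis unfolding L_def m_def .
qed

section \<open>Compositions of morphisms\<close>

lemma nonerasing_morphism_compose:
  assumes "nonerasing_morphism B A h" "nonerasing_morphism C B g"
  shows "nonerasing_morphism C A (h \<circ> g)"
  unfolding nonerasing_morphism_def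
proof (intro conjI ballI)
  fix c assume c: "c \<in> C"
  then have g: "g [c] \<in> lists B" "g [c] \<noteq> []"
    using assms(2) by (auto simp: nonerasing_morphism_def)
  \<comment> \<open>Non-erasure is given for letters only, so the first letter of
    \<open>g [c]\<close> is split off.\<close>
  then obtain b w where bw: "g [c] = [b] @ w" by (cases "g [c]") auto
  then have "[b] \<in> lists B" "w \<in> lists B" "b \<in> B" using g by auto
  then show "(h \<circ> g) [c] \<noteq> []"
    using assms(1) unfolding nonerasing_morphism_def comp_def bw by (metis append_is_Nil_conv)
qed (use assms in \<open>auto simp: nonerasing_morphism_def\<close>)

lemma nonerasing_morphism_concat:
  assumes "nonerasing_morphism B A h" "w \<in> lists B"
  shows "h w = concat (map (\<lambda>b. h [b]) w)"
  using assms(2)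
proof (induction w)
  case Nil
  then show ?case using assms(1) by (simp add: nonerasing_morphism_def)
next
  case (Cons b w)
  then have "[b] \<in> lists B" "w \<in> lists B" by auto
  then have "h ([b] @ w) = h [b] @ h w"
    using assms(1) unfolding nonerasing_morphism_def by blast
  with Cons show ?case by simp
qed

lemma nonerasing_morphism_length_letter:
  assumes "nonerasing_morphism B A h" "w \<in> lists B" "b \<in> set w"
  shows "length (h [b]) \<le> length (h w)"
proof -
  obtain p s where "w = p @ b # s" using assms(3) by (auto simp: in_set_conv_decomp)
  then show ?thesis
    using nonerasing_morphism_concat[OF assms(1,2)] by simp
qed

lemma directive_sequence_image:
  assumes "directive_sequence A \<tau>" "a \<in> A (Suc n)"
  shows "\<tau> n [a] \<in> lists (A n)" "\<tau> n [a] \<noteq> []"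
  using assms by (auto simp: directive_sequence_def nonerasing_morphism_def)

lemma compose_upto_morphism:
  assumes "directive_sequence A \<tau>"
  shows "nonerasing_morphism (A N) (A 0) (compose_upto \<tau> N)"
proof (induction N)
  case 0
  then show ?case by (simp add: nonerasing_morphism_def)
next
  case (Suc N)
  have "nonerasing_morphism (A (Suc N)) (A N) (\<tau> N)"
    using assms by (simp add: directive_sequence_def)
  then show ?case unfolding compose_upto.simps by (rule nonerasing_morphism_compose[OF Suc.IH])
qed

text \<open>The witness is \<open>w\<close> pushed down through \<open>\<tau> (N - 1)\<close>, ...,
  \<open>\<tau> n\<close>. Thus images of higher letters are concatenations of images of letters of
  level \<open>n\<close>.\<close>

lemma compose_upto_factorization:
  assumes "directive_sequence A \<tau>" "n \<le> N" "w \<in> lists (A N)"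
  shows "\<exists>w'\<in>lists (A n). compose_upto \<tau> N w = compose_upto \<tau> n w'"
  using assms(2,3)
proof (induction N arbitrary: w rule: nat_induct_at_least)
  case base
  then show ?case by blast
next
  case (Suc N)
  have "\<tau> N w \<in> lists (A N)"
    using assms(1) Suc.prems by (auto simp: directive_sequence_def nonerasing_morphism_def)
  then show ?case using Suc.IH by simp
qed

text \<open>Positivity of \<open>\<tau> N\<close> puts \<open>c\<close> into the image of every
  letter of level \<open>Suc N\<close>. Above that level it suffices to follow any letter of the
  non-empty image \<open>\<tau> M [d]\<close>.\<close>

lemma compose_upto_length_mono:
  assumes "directive_sequence A \<tau>" "positive_sequence A \<tau>" "1 \<le> N" "N < n"
    and "c \<in> A N" "d \<in> A n"
  shows "length (compose_upto \<tau> N [c]) \<le> length (compose_upto \<tau> n [d])"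
proof -
  have step: "length (compose_upto \<tau> M [b]) \<le> length (compose_upto \<tau> (Suc M) [d])"
    if "d \<in> A (Suc M)" "b \<in> set (\<tau> M [d])" for M b d
    using nonerasing_morphism_length_letter[OF compose_upto_morphism[OF assms(1)]]
      directive_sequence_image(1)[OF assms(1) that(1)] that(2) by simp
  from assms(4) have "Suc N \<le> n" by simp
  then show ?thesis using assms(6)
  proof (induction n arbitrary: d rule: nat_induct_at_least)
    case base
    then have "c \<in> set (\<tau> N [d])"
      using assms(2,3,5) unfolding positive_sequence_def by blast
    then show ?case using step base by blast
  next
    case (Suc M)
    obtain b where b: "b \<in> set (\<tau> M [d])" "b \<in> A M"
      using directive_sequence_image[OF assms(1) Suc.prems] by (cases "\<tau> M [d]") auto
    from Suc.IH[OF b(2)] step[OF Suc.prems b(1)] show ?case by (rule order_trans)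
  qed
qed

lemma directive_sequence_nonempty_below:
  assumes "directive_sequence A \<tau>" "n \<le> N" "A N \<noteq> {}"
  shows "A n \<noteq> {}"
  using assms(2,3)
proof (induction N rule: nat_induct_at_least)
  case (Suc N)
  then obtain a where "a \<in> A (Suc N)" by blast
  then have "A N \<noteq> {}"
    using directive_sequence_image[OF assms(1)] by (cases "\<tau> N [a]") fastforce+
  then show ?case by (rule Suc.IH)
qed

section \<open>Complexity of the subshift\<close>

lemma length_factor_at [simp]: "length (factor_at x i n) = n"
  by (simp add: factor_at_def)

lemma prefix_factor_at: "n \<le> m \<Longrightarrow> prefix (factor_at x i n) (factor_at x i m)"
  unfolding factor_at_def by (intro map_mono_prefix) (metis le_Suc_ex prefixI upt_add_eq_append zero_le)

text \<open>
  Extending a factor of \<open>x\<close> beyond the lengths of the finitely many images of letters of the levels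
  up to \<open>n\<close> forces it to occur in the image of a letter of a higher level.
\<close>

lemma sadic_factor_high_level:
  assumes "directive_sequence A \<tau>" "x \<in> sadic_subshift A \<tau>"
  shows "\<exists>N>n. \<exists>c\<in>A N. sublist (factor_at x i L) (compose_upto \<tau> N [c])"
proof -
  define S where "S = (\<Union>N\<le>n. (\<lambda>c. length (compose_upto \<tau> N [c])) ` A N)"
  have "finite S" using assms(1) unfolding S_def directive_sequence_def by blast
  then obtain B where B: "\<forall>s\<in>S. s \<le> B" by (meson finite_nat_set_iff_bounded_le)
  obtain N c where N: "c \<in> A N" "sublist (factor_at x i (L + Suc B)) (compose_upto \<tau> N [c])"
    using assms(2) unfolding sadic_subshift_def by blast
  have "n < N"
  proof (rule ccontr)
    assume "\<not> n < N"
    then have "length (compose_upto \<tau> N [c]) \<in> S" using N(1) unfolding S_def by auto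
    then have "length (compose_upto \<tau> N [c]) \<le> B" using B by blast
    with sublist_length_le[OF N(2)] show False by simp
  qed
  moreover have "sublist (factor_at x i L) (compose_upto \<tau> N [c])"
    using prefix_imp_sublist[OF prefix_factor_at] N(2)
    by (rule sublist_order.order.trans) simp
  ultimately show ?thesis using N(1) by blast
qed

text \<open>A factor of length \<open>K\<close> lies in the image of a single letter of a positive
  level; monotonicity passes its length on to all letters of all higher levels.\<close>

lemma sadic_level_lengths_unbounded:
  assumes "directive_sequence A \<tau>" "positive_sequence A \<tau>" "sadic_subshift A \<tau> \<noteq> {}"
  shows "\<exists>n0. \<forall>n>n0. \<forall>d\<in>A n. K \<le> length (compose_upto \<tau> n [d])"
proof -
  obtain x where "x \<in> sadic_subshift A \<tau>" using assms(3) by blast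
  then obtain N c where N: "N > 0" "c \<in> A N" "sublist (factor_at x 0 K) (compose_upto \<tau> N [c])"
    using sadic_factor_high_level[OF assms(1), of x 0 0 K] by blast
  have "K \<le> length (compose_upto \<tau> N [c])" using sublist_length_le[OF N(3)] by simp
  moreover have "length (compose_upto \<tau> N [c]) \<le> length (compose_upto \<tau> n [d])"
    if "n > N" "d \<in> A n" for n d
    using compose_upto_length_mono[OF assms(1,2) _ that(1) N(2) that(2)] N(1) by simp
  ultimately show ?thesis using order_trans by blast
qed

text \<open>The case \<open>a = b\<close> is allowed and covers levels with one letter.\<close>

lemma complexity_two_letters:
  assumes "directive_sequence A \<tau>" "A n = {a, b}"
    and "length (compose_upto \<tau> n [b]) \<le> length (compose_upto \<tau> n [a])"
  defines "L \<equiv> length (compose_upto \<tau> n [a])"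
  shows "real (complexity (sadic_subshift A \<tau>) L) / (real L)\<^sup>2
         \<le> 6 / real (length (compose_upto \<tau> n [b]))"
proof -
  let ?u = "compose_upto \<tau> n [a]" and ?v = "compose_upto \<tau> n [b]"
  note mor = compose_upto_morphism[OF assms(1), of n]
  have v: "?v \<noteq> []" using mor assms(2) by (simp add: nonerasing_morphism_def)
  have sub: "{factor_at x i L |x i. x \<in> sadic_subshift A \<tau>} \<subseteq> two_word_factors ?u ?v"
  proof safe
    fix x i assume "x \<in> sadic_subshift A \<tau>"
    then obtain N c where N: "n < N" "c \<in> A N" "sublist (factor_at x i L) (compose_upto \<tau> N [c])"
      using sadic_factor_high_level[OF assms(1)] by blast
    then obtain w where w: "w \<in> lists (A n)" "compose_upto \<tau> N [c] = compose_upto \<tau> n w"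
      using compose_upto_factorization[OF assms(1), of n N "[c]"] by auto
    have "compose_upto \<tau> N [c] = concat (map (\<lambda>d. compose_upto \<tau> n [d]) w)"
      using nonerasing_morphism_concat[OF mor w(1)] w(2) by simp
    moreover have "set (map (\<lambda>d. compose_upto \<tau> n [d]) w) \<subseteq> {?u, ?v}"
      using w(1) assms(2) by auto
    ultimately show "factor_at x i L \<in> two_word_factors ?u ?v"
      using N(3) unfolding two_word_factors_def L_def by (metis (mono_tags, lifting) length_factor_at mem_Collect_eq)
  qed
  have "complexity (sadic_subshift A \<tau>) L \<le> card (two_word_factors ?u ?v)"
    unfolding complexity_def by (rule card_mono[OF two_word_factors_bound(1)[OF v assms(3)] sub])
  then have "real (complexity (sadic_subshift A \<tau>) L) / (real L)\<^sup>2
      \<le> real (card (two_word_factors ?u ?v)) / (real L)\<^sup>2"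
    by (intro divide_right_mono) auto
  also have "\<dots> \<le> 6 / real (length ?v)"
    using two_word_factors_ratio[OF v assms(3)] unfolding L_def .
  finally show ?thesis .
qed

lemma complexity_ratio_small:
  fixes e :: real
  assumes "directive_sequence A \<tau>" "positive_sequence A \<tau>" "\<exists>\<^sub>F n in sequentially. card (A n) \<le> 2"
    and "e > 0"
  shows "\<exists>L\<ge>K. real (complexity (sadic_subshift A \<tau>) L) / (real L)\<^sup>2 < e"
proof (cases "sadic_subshift A \<tau> = {}")
  case True
  then show ?thesis using assms(4) by (auto simp: complexity_def)
next
  case False
  \<comment> \<open>The maximum serves both goals: \<open>L \<ge> K\<close> for the witness and
    \<open>6 / m < e\<close> for the ratio.\<close>
  define m where "m = max K (nat \<lceil>6 / e\<rceil> + 1)"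
  have m: "m \<ge> K" "real m > 6 / e" "m > 0" unfolding m_def by linarith+
  obtain n0 where n0: "\<forall>n>n0. \<forall>d\<in>A n. m \<le> length (compose_upto \<tau> n [d])"
    using sadic_level_lengths_unbounded[OF assms(1,2) False] by blast
  obtain n where n: "n > n0" "card (A n) \<le> 2"
    using assms(3) unfolding frequently_sequentially by (meson Suc_le_lessD)
  obtain x where x: "x \<in> sadic_subshift A \<tau>" using False by blast
  \<comment> \<open>The cardinality bound alone would permit an empty alphabet; a point of the
    subshift supplies a letter of a higher level, and non-empty images bring letters down to level
    \<open>n\<close>.\<close>
  then have "A n \<noteq> {}"
    using sadic_factor_high_level[OF assms(1) x, of n 0 0] directive_sequence_nonempty_below[OF assms(1)]
    by (metis emptyE less_imp_le_nat)
  moreover have "finite (A n)" using assms(1) by (simp add: directive_sequence_def)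
  ultimately have "card (A n) = 1 \<or> card (A n) = 2" using n(2) card_gt_0_iff[of "A n"] by linarith
  then obtain a b where "A n = {a, b}"
    by (metis card_1_singletonE card_2_iff insert_absorb2)
  then obtain a b where ab: "A n = {a, b}"
    "length (compose_upto \<tau> n [b]) \<le> length (compose_upto \<tau> n [a])"
    by (metis insert_commute linear)
  define L where "L = length (compose_upto \<tau> n [a])"
  have mb: "m \<le> length (compose_upto \<tau> n [b])" using n0 n(1) ab(1) by blast
  have "real (complexity (sadic_subshift A \<tau>) L) / (real L)\<^sup>2
      \<le> 6 / real (length (compose_upto \<tau> n [b]))"
    using complexity_two_letters[OF assms(1) ab] unfolding L_def .
  also have "\<dots> \<le> 6 / real m" using mb m(3) by (simp add: frac_le)
  also have "\<dots> < e" using m(2,3) assms(4) by (simp add: field_simps)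
  finally show ?thesis using mb m(1) ab(2) unfolding L_def by (meson order_trans)
qed

theorem corollary6p6:
  fixes A :: "nat \<Rightarrow> 'a set"
    and \<tau> :: "nat \<Rightarrow> 'a list \<Rightarrow> 'a list"
  assumes "directive_sequence A \<tau>"
    and "positive_sequence A \<tau>"
    and "liminf (\<lambda>n. enat (card (A n))) \<le> 2"
  shows "liminf (\<lambda>n. ereal (real (complexity (sadic_subshift A \<tau>) n) / (real n)\<^sup>2)) = 0"
    (is "liminf ?f = 0")
proof (rule antisym)
  have freq: "\<exists>\<^sub>F n in sequentially. card (A n) \<le> 2"
  proof (rule ccontr)
    assume "\<not> ?thesis"
    then have "\<forall>\<^sub>F n in sequentially. 3 \<le> enat (card (A n))"
      unfolding not_frequently by eventually_elim (simp add: numeral_eq_enat)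
    then have "3 \<le> liminf (\<lambda>n. enat (card (A n)))" by (rule Liminf_bounded)
    then have "(3::enat) \<le> 2" using assms(3) by (rule order_trans)
    then show False by simp
  qed
  show "liminf ?f \<le> 0"
  proof (rule ccontr)
    assume "\<not> ?thesis"
    then have "0 < liminf ?f" by simp
    \<comment> \<open>A real number strictly between 0 and the lower limit would eventually bound
      the ratio from below, against its being small at arbitrarily large lengths.\<close>
    then obtain e where e: "0 < ereal e" "ereal e < liminf ?f"
      using ereal_dense2 by blast
    from less_LiminfD[OF e(2)] obtain K where "\<forall>n\<ge>K. ereal e < ?f n"
      unfolding eventually_sequentially by blast
    moreover obtain L where "L \<ge> K" "real (complexity (sadic_subshift A \<tau>) L) / (real L)\<^sup>2 < e"
      using complexity_ratio_small[OF assms(1,2) freq, of e K] e(1) by auto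
    ultimately show False by fastforce
  qed
  show "0 \<le> liminf ?f" by (rule Liminf_bounded) simp
qed

end
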